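(* Let $\varepsilon>0$ be an accuracy, $\nu\in\mathcal P(S)$ an initial distribution, and $D\subseteq S$ a (measurable) domain with $\operatorname{diam}_d(D)\le R$ for some $R>0$. Let $\pi^u$ be the unadjusted kernel and $\pi$ the adjusted kernel with $\mu\pi=\mu$ described in the context. Suppose the following. (i) There exist $\rho>0$ and, for all $x,\tilde x\in D$, a faithful coupling $\Pi^u_{Contr}((x,\tilde x),\cdot)$ of $\pi^u(x,\cdot)$ and $\pi^u(\tilde x,\cdot)$ such that $$\mathbb E\, d(X^u,\widetilde X^u)\le (1-\rho)\,d(x,\tilde x)\qquad\text{for }(X^u,\widetilde X^u)\sim\Pi^u_{Contr}((x,\tilde x),\cdot).$$ (ii) There exist $C_{Reg}>0$ and, for all $x,\tilde x\in D$, a faithful coupling $\Pi^u_{Reg}((x,\tilde x),\cdot)$ of $\pi^u(x,\cdot)$ and $\pi^u(\tilde x,\cdot)$ such that $$\Pi^u_{Reg}\big((x,\tilde x),\Delta^c\big)\le C_{Reg}\,d(x,\tilde x).$$ (iii) With the epoch length $$\mathfrak E=\lceil \rho^{-1}\log(3e\,C_{Reg}R)\rceil+1$$ it holds that $$\mathfrak E\,\sup_{x\in D}\mathbb P(A(x)^c)\le (3e)^{-1}.$$ (iv) With the total number of transition steps $$\mathfrak H=\mathfrak E\,\lceil\log(2/\varepsilon)\rceil$$ and $T=\inf\{k\ge 0: X_k\notin D\}$, where $(X_k)_{k\ge0}$ is a Markov chain with transition kernel $\pi$, it holds that $$\mathbb P(T\le\mathfrak H)\le\varepsilon/4$$ both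 for $X_0\sim\nu$ and for $X_0\sim\mu$. Here it is understood that $\mathfrak E\ge1$ and that the number of epochs $\lceil\log(2/\varepsilon)\rceil$ is nonnegative. Then $$\tau_{\operatorname{mix}}(\varepsilon,\nu)\le\mathfrak H .$$
   Context: $(\Omega,\mathcal A,\mathbb P)$ is a probability space and $S$ is a Polish space with metric $d$ and Borel $\sigma$-algebra $\mathcal B$; $\mathcal P(S)$ is the set of probability measures on $(S,\mathcal B)$ and $\mu\in\mathcal P(S)$ is fixed. $\Delta=\{(x,x):x\in S\}$ is the diagonal in $S\times S$. Kernels. $\pi^u$ (the unadjusted kernel) and $\pi^r$ are probability kernels on $(S,\mathcal B)$. The adjusted kernel $\pi$ has transition steps $X\sim\pi(x,\cdot)$ of the form $$X(\omega)=\Phi(\omega,x)\mathbf 1_{A(x)}(\omega)+\Psi(\omega,x)\mathbf 1_{A(x)^c}(\omega),\qquad \omega\in\Omega$$ (i.e. $X=\Phi(x)$ on $A(x)$ and $X=\Psi(x)$ on $A(x)^c$), where $\Phi,\Psi:\Omega\times S\to S$ are product measurable with $\Phi(x):=\Phi(\cdot,x)\sim\pi^u(x,\cdot)$ and $\Psi(x):=\Psi(\cdot,x)\sim\pi^r(x,\cdot)$ for all $x\in S$, and the acceptance event is $A(x)=\{\mathcal U\le\alpha(x,\Phi(x))\}$ with an acceptance probability function $\alpha$ (measurable, $[0,1]$-valued) and an independent random variable $\mathcal U\sim\mathrm{Unif}(0,1)$. The adjusted kernel leaves $\mu$ invariant: $\mu\pi=\mu$. Couplings. A coupling $\Pi((x,\tilde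 x),\cdot)$ (depending on $(x,\tilde x)$ as a transition kernel) is faithful if $\Pi((x,x),\Delta)=1$ for all $x$. Mixing time. For $\delta>0$ and $\eta\in\mathcal P(S)$, $$\tau_{\operatorname{mix}}(\delta,\eta)=\inf\{n\ge0:\|\eta\pi^n-\mu\|_{\mathsf{TV}}\le\delta\},$$ where $\|\eta_1-\eta_2\|_{\mathsf{TV}}=\sup_{B\in\mathcal B}|\eta_1(B)-\eta_2(B)|=\inf\mathbb P(Y_1\neq Y_2)$, the infimum being over all couplings $(Y_1,Y_2)$ of $\eta_1,\eta_2$. *)

theory Defs
  imports "HOL-Probability.Probability"
begin

section \<open>Kernels, total variation and mixing times\<close>

text \<open>Probability kernels on the Borel space of \<open>'s\<close> are the measurable maps into the Giry
  probability algebra, so that \<open>\<eta> \<bind> K\<close> is the law \<open>\<eta>K\<close>.\<close>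

abbreviation prob_kernel :: "('s::topological_space \<Rightarrow> 's measure) \<Rightarrow> bool" where
  "prob_kernel K \<equiv> K \<in> borel \<rightarrow>\<^sub>M prob_algebra borel"

abbreviation prob_law :: "'s::topological_space measure \<Rightarrow> bool" where
  "prob_law \<eta> \<equiv> \<eta> \<in> space (prob_algebra borel)"

definition kernel_iter :: "('s \<Rightarrow> 's measure) \<Rightarrow> nat \<Rightarrow> 's measure \<Rightarrow> 's measure" where
  "kernel_iter K n \<eta> = ((\<lambda>\<zeta>. \<zeta> \<bind> K) ^^ n) \<eta>"

definition tv_dist :: "'s::topological_space measure \<Rightarrow> 's measure \<Rightarrow> real" where
  "tv_dist \<eta>1 \<eta>2 = (SUP B\<in>sets borel. \<bar>measure \<eta>1 B - measure \<eta>2 B\<bar>)"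

text \<open>The value is \<open>\<infinity>\<close> if the accuracy \<open>\<delta>\<close> is never reached.\<close>

definition mixing_time ::
  "('s::topological_space \<Rightarrow> 's measure) \<Rightarrow> 's measure \<Rightarrow> real \<Rightarrow> 's measure \<Rightarrow> enat" where
  "mixing_time K \<mu> \<delta> \<eta> = (INF n\<in>{n. tv_dist (kernel_iter K n \<eta>) \<mu> \<le> \<delta>}. enat n)"

section \<open>Couplings\<close>

definition coupling ::
  "'s::topological_space measure \<Rightarrow> 's measure \<Rightarrow> ('s \<times> 's) measure \<Rightarrow> bool" where
  "coupling P Q C \<longleftrightarrow>
     C \<in> space (prob_algebra (borel \<Otimes>\<^sub>M borel)) \<and> distr C borel fst = P \<and> distr C borel snd = Q"

text \<open>A transition kernel on \<open>D \<times> D\<close> whose value at \<open>(x, y)\<close> couples \<open>K x\<close> and \<open>K y\<close>, and which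
  leaves the diagonal, \<open>Id\<close>, invariant.\<close>

definition faithful_coupling_on ::
  "'s set \<Rightarrow> ('s::topological_space \<Rightarrow> 's measure) \<Rightarrow> ('s \<times> 's \<Rightarrow> ('s \<times> 's) measure) \<Rightarrow> bool" where
  "faithful_coupling_on D K C \<longleftrightarrow>
     C \<in> restrict_space (borel \<Otimes>\<^sub>M borel) (D \<times> D) \<rightarrow>\<^sub>M prob_algebra (borel \<Otimes>\<^sub>M borel) \<and>
     (\<forall>x\<in>D. \<forall>y\<in>D. coupling (K x) (K y) (C (x, y))) \<and>
     (\<forall>x\<in>D. measure (C (x, x)) Id = 1)"

section \<open>Adjusted kernels\<close>

definition accept_event ::
  "'w measure \<Rightarrow> ('w \<Rightarrow> real) \<Rightarrow> ('s \<Rightarrow> 's \<Rightarrow> real) \<Rightarrow> ('w \<Rightarrow> 's \<Rightarrow> 's) \<Rightarrow> 's \<Rightarrow> 'w set" where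
  "accept_event M U \<alpha> \<Phi> x = {\<omega> \<in> space M. U \<omega> \<le> \<alpha> x (\<Phi> \<omega> x)}"

definition adjusted_step ::
  "'w measure \<Rightarrow> ('w \<Rightarrow> real) \<Rightarrow> ('s \<Rightarrow> 's \<Rightarrow> real) \<Rightarrow> ('w \<Rightarrow> 's \<Rightarrow> 's) \<Rightarrow> ('w \<Rightarrow> 's \<Rightarrow> 's) \<Rightarrow>
   's \<Rightarrow> 'w \<Rightarrow> 's" where
  "adjusted_step M U \<alpha> \<Phi> \<Psi> x \<omega> = (if \<omega> \<in> accept_event M U \<alpha> \<Phi> x then \<Phi> \<omega> x else \<Psi> \<omega> x)"

definition adjusted_kernel ::
  "'w measure \<Rightarrow> ('w \<Rightarrow> real) \<Rightarrow> ('s \<Rightarrow> 's \<Rightarrow> real) \<Rightarrow> ('w \<Rightarrow> 's::topological_space \<Rightarrow> 's) \<Rightarrow>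
   ('w \<Rightarrow> 's \<Rightarrow> 's) \<Rightarrow> 's \<Rightarrow> 's measure" where
  "adjusted_kernel M U \<alpha> \<Phi> \<Psi> x = distr M borel (adjusted_step M U \<alpha> \<Phi> \<Psi> x)"

text \<open>Independence of the generated \<open>\<sigma>\<close>-algebras; \<^const>\<open>prob_space.indep_var\<close> only covers two
  random variables of the same type.\<close>

definition indep_rv ::
  "'w measure \<Rightarrow> 'a measure \<Rightarrow> ('w \<Rightarrow> 'a) \<Rightarrow> 'b measure \<Rightarrow> ('w \<Rightarrow> 'b) \<Rightarrow> bool" where
  "indep_rv M N X N' Y \<longleftrightarrow>
     prob_space.indep_set M (sets (vimage_algebra (space M) X N)) (sets (vimage_algebra (space M) Y N'))"

section \<open>Markov chains and exit times\<close>

definition natural_filtration ::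
  "'w measure \<Rightarrow> (nat \<Rightarrow> 'w \<Rightarrow> 's::topological_space) \<Rightarrow> nat \<Rightarrow> 'w measure" where
  "natural_filtration N X n = sigma (space N) (\<Union>i\<le>n. {X i -` B \<inter> space N |B. B \<in> sets borel})"

definition markov_chain ::
  "'w measure \<Rightarrow> (nat \<Rightarrow> 'w \<Rightarrow> 's::topological_space) \<Rightarrow> ('s \<Rightarrow> 's measure) \<Rightarrow> 's measure \<Rightarrow> bool" where
  "markov_chain N X K \<eta> \<longleftrightarrow>
     prob_space N \<and> (\<forall>n. X n \<in> N \<rightarrow>\<^sub>M borel) \<and> distr N borel (X 0) = \<eta> \<and>
     (\<forall>n. \<forall>B\<in>sets borel. AE \<omega> in N.
        real_cond_exp N (natural_filtration N X n) (indicator (X (Suc n) -` B \<inter> space N)) \<omega>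
          = measure (K (X n \<omega>)) B)"

definition exit_time :: "(nat \<Rightarrow> 'w \<Rightarrow> 's) \<Rightarrow> 's set \<Rightarrow> 'w \<Rightarrow> enat" where
  "exit_time X D \<omega> = (INF k\<in>{k. X k \<omega> \<notin> D}. enat k)"

section \<open>Epochs\<close>

text \<open>Integers rather than naturals, since the ceilings may be negative for some parameters.\<close>

definition epoch_length :: "real \<Rightarrow> real \<Rightarrow> real \<Rightarrow> int" where
  "epoch_length \<rho> C R = \<lceil>ln (3 * exp 1 * C * R) / \<rho>\<rceil> + 1"

definition epoch_count :: "real \<Rightarrow> int" where
  "epoch_count \<epsilon> = \<lceil>ln (2 / \<epsilon>)\<rceil>"

definition total_steps :: "real \<Rightarrow> real \<Rightarrow> real \<Rightarrow> real \<Rightarrow> int" where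
  "total_steps \<rho> C R \<epsilon> = epoch_length \<rho> C R * epoch_count \<epsilon>"

end

theory Submission
  imports Defs
begin

text \<open>
  The argument is a coupling argument in which the adjusted chains are never coupled. It works with
  a dual statement about functions. For a measurable \<open>B\<close> let \<open>h\<^sub>n x\<close> be the probability that the
  adjusted chain started at \<open>x\<close> is in \<open>B\<close> after \<open>n\<close> steps, and let \<open>v\<^sub>n x\<close> be the probability that
  it has been outside \<open>D\<close> at some time before \<open>n\<close>. The claim carried from step to step is
  \<open>h\<^sub>n s - h\<^sub>n t \<le> a \<cdot> w (s, t) + v\<^sub>n s + v\<^sub>n t\<close> for all \<open>s\<close> and \<open>t\<close>. Here \<open>a\<close> stands for
  a bound on the probability that two coupled copies miss each other in all later epochs, and \<open>w\<close> for
  a bound on the probability that they do not meet in what is left of the current one. Points outside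
  \<open>D\<close> satisfy this for free once \<open>n > 0\<close>, because there \<open>v\<^sub>n\<close> equals \<open>1\<close>. The diagonal does too,
  because the left-hand side vanishes there.

  One step is the comparison \<open>integral_diff_le_minorants\<close>. The kernel \<open>\<pi> x\<close> dominates
  \<open>\<alpha> x z \<cdot> \<pi>\<^sup>u x (dz)\<close>, the part of a step that is accepted. On the common accepted part of a coupling
  of \<open>\<pi>\<^sup>u x\<close> and \<open>\<pi>\<^sup>u y\<close> the bound \<open>w\<close> can be integrated; the remaining mass is at most the sum of
  the two rejection probabilities, and there the crude bound with \<open>w = 1\<close> suffices. The two
  remainders can be estimated separately, since a two-point bound \<open>h s - h t \<le> a + v s + v t\<close> separates: some
  constant \<open>c\<close> satisfies \<open>h - v - a \<le> c \<le> h + v\<close>.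

  Functions evolve backwards in time, so the first step applied is the last one of an epoch: the
  regularising coupling turns \<open>w = 1[s \<noteq> t]\<close> into \<open>C_Reg \<cdot> dist s t + 2p\<close>, where \<open>p\<close> bounds the
  rejection probability. Each contractive step then multiplies the distance term by at most
  \<open>exp (- \<rho>)\<close> and adds \<open>2p\<close>. After an epoch the distance term is at most \<open>1/(3e)\<close> and the
  rejections contribute at most \<open>2/(3e)\<close>, so every epoch costs a factor \<open>1/e\<close>, and all epochs together
  leave at most \<open>\<epsilon>/2\<close>. Integration against \<open>\<nu>\<close> and \<open>\<mu>\<close> adds the two exit probabilities, at most
  \<open>\<epsilon>/4\<close> each.
\<close>

section \<open>Unit functions and the action of a kernel\<close>

definition unit_fun :: "('s::topological_space \<Rightarrow> real) \<Rightarrow> bool" where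
  "unit_fun f \<longleftrightarrow> f \<in> borel_measurable borel \<and> (\<forall>x. 0 \<le> f x \<and> f x \<le> 1)"

definition kernel_act :: "('s \<Rightarrow> 's measure) \<Rightarrow> ('s \<Rightarrow> real) \<Rightarrow> 's \<Rightarrow> real" where
  "kernel_act K f x = (\<integral>y. f y \<partial>K x)"

text \<open>The backward recursion of the exit probability: \<open>(exit_step K D ^^ n) (\<lambda>_. 0) x\<close> is the
  probability that the chain started at \<open>x\<close> has visited the complement of \<open>D\<close> before time \<open>n\<close>.\<close>

definition exit_step :: "('s \<Rightarrow> 's measure) \<Rightarrow> 's set \<Rightarrow> ('s \<Rightarrow> real) \<Rightarrow> 's \<Rightarrow> real" where
  "exit_step K D v x = (if x \<in> D then kernel_act K v x else 1)"

lemma unit_funD: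
  assumes "unit_fun f"
  shows "f \<in> borel_measurable borel" "0 \<le> f x" "f x \<le> 1"
  using assms by (auto simp: unit_fun_def)

lemma prob_lawD:
  assumes "P \<in> space (prob_algebra N)"
  shows "prob_space P" "sets P = sets N" "space P = space N"
  using assms sets_eq_imp_space_eq[of P N] by (auto simp: space_prob_algebra)

lemma integrable_bounded_prob_law:
  fixes f :: "'a \<Rightarrow> real"
  assumes "P \<in> space (prob_algebra N)" "f \<in> borel_measurable N" "\<And>x. \<bar>f x\<bar> \<le> B"
  shows "integrable P f"
proof -
  interpret prob_space P using assms(1) by (rule prob_lawD)
  have "f \<in> borel_measurable P"
    using assms(2) prob_lawD(2)[OF assms(1)] by (simp cong: measurable_cong_sets)
  then show ?thesis
    using assms(3) by (intro integrable_const_bound[of _ B]) auto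
qed

lemma integrable_unit_fun:
  assumes "prob_law P" "unit_fun f"
  shows "integrable P f"
  using assms unit_funD[OF assms(2)]
  by (intro integrable_bounded_prob_law[of P borel f 1]) auto

lemma integral_unit_fun:
  assumes "prob_law P" "unit_fun f"
  shows "0 \<le> (\<integral>x. f x \<partial>P)" "(\<integral>x. f x \<partial>P) \<le> 1"
proof -
  interpret prob_space P using assms(1) by (rule prob_lawD)
  show "0 \<le> (\<integral>x. f x \<partial>P)" by (simp add: unit_funD[OF assms(2)])
  show "(\<integral>x. f x \<partial>P) \<le> 1"
    using integrable_unit_fun[OF assms] unit_funD[OF assms(2)] by (intro integral_le_const) auto
qed

lemma prob_kernelD:
  assumes "prob_kernel K"
  shows "prob_law (K x)"
  using measurable_space[OF assms, of x] by simp

lemma unit_fun_kernel_act: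
  assumes "prob_kernel K" "unit_fun f"
  shows "unit_fun (kernel_act K f)"
proof -
  have "kernel_act K f \<in> borel_measurable borel"
    unfolding kernel_act_def
    using measurable_compose[OF measurable_prob_algebraD[OF assms(1)]
        integral_measurable_subprob_algebra[OF unit_funD(1)[OF assms(2)]]] by simp
  then show ?thesis
    using integral_unit_fun[OF prob_kernelD[OF assms(1)] assms(2)]
    by (auto simp: unit_fun_def kernel_act_def)
qed

lemma unit_fun_exit_step:
  assumes "prob_kernel K" "D \<in> sets borel" "unit_fun f"
  shows "unit_fun (exit_step K D f)"
proof -
  note u = unit_fun_kernel_act[OF assms(1,3)]
  have [measurable]: "kernel_act K f \<in> borel_measurable borel" "D \<in> sets borel"
    using unit_funD[OF u] assms by auto
  have "exit_step K D f \<in> borel_measurable borel"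
    unfolding exit_step_def by measurable
  then show ?thesis
    using unit_funD[OF u] by (auto simp: unit_fun_def exit_step_def)
qed

lemma unit_fun_kernel_act_funpow:
  "prob_kernel K \<Longrightarrow> unit_fun f \<Longrightarrow> unit_fun ((kernel_act K ^^ n) f)"
  by (induction n) (auto intro: unit_fun_kernel_act)

lemma unit_fun_exit_step_funpow:
  "prob_kernel K \<Longrightarrow> D \<in> sets borel \<Longrightarrow> unit_fun f \<Longrightarrow> unit_fun ((exit_step K D ^^ n) f)"
  by (induction n) (auto intro: unit_fun_exit_step)

lemma prob_law_kernel_iter:
  assumes "prob_kernel K" "prob_law \<eta>"
  shows "prob_law (kernel_iter K n \<eta>)"
proof (induction n)
  case 0
  then show ?case using assms by (simp add: kernel_iter_def)
next
  case (Suc n)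
  then show ?case
    using prob_space_bind'[OF Suc assms(1)] sets_bind'[OF Suc assms(1)]
    by (simp add: kernel_iter_def space_prob_algebra)
qed

lemma integral_bind_kernel:
  assumes "prob_kernel K" "finite_measure \<eta>" "sets \<eta> = sets borel" "unit_fun f"
  shows "(\<integral>x. f x \<partial>(\<eta> \<bind> K)) = (\<integral>x. kernel_act K f x \<partial>\<eta>)"
  unfolding kernel_act_def
proof (rule integral_bind[where K=borel and B=1 and B'=1])
  show "K \<in> \<eta> \<rightarrow>\<^sub>M subprob_algebra borel"
    using measurable_prob_algebraD[OF assms(1)] assms(3) by (simp cong: measurable_cong_sets)
  show "AE x in \<eta>. emeasure (K x) (space (K x)) \<le> ennreal 1"
    using prob_space.emeasure_space_1[OF prob_lawD(1)[OF prob_kernelD[OF assms(1)]]] by simp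
qed (use assms unit_funD[OF assms(4)] in auto)

lemma integral_kernel_iter:
  assumes "prob_kernel K" "prob_law \<eta>" "unit_fun f"
  shows "(\<integral>x. f x \<partial>kernel_iter K n \<eta>) = (\<integral>x. (kernel_act K ^^ n) f x \<partial>\<eta>)"
  using assms(3)
proof (induction n arbitrary: f)
  case 0
  then show ?case by (simp add: kernel_iter_def)
next
  case (Suc n)
  note law = prob_law_kernel_iter[OF assms(1,2), of n]
  interpret prob_space "kernel_iter K n \<eta>" by (rule prob_lawD(1)[OF law])
  have "(\<integral>x. f x \<partial>kernel_iter K (Suc n) \<eta>) = (\<integral>x. f x \<partial>(kernel_iter K n \<eta> \<bind> K))"
    by (simp add: kernel_iter_def)
  also have "\<dots> = (\<integral>x. kernel_act K f x \<partial>kernel_iter K n \<eta>)"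
    using prob_lawD(2)[OF law] Suc.prems
    by (intro integral_bind_kernel[OF assms(1)]) (auto intro: finite_measure_axioms)
  also have "\<dots> = (\<integral>x. (kernel_act K ^^ n) (kernel_act K f) x \<partial>\<eta>)"
    by (intro Suc.IH unit_fun_kernel_act[OF assms(1) Suc.prems])
  finally show ?case by (simp add: funpow_swap1)
qed

section \<open>Comparison of two laws through a coupling of minorants\<close>

text \<open>This says \<open>\<beta> \<cdot> P0 \<le> P\<close> as measures. It is phrased with bounded functions, which is how it is
  used.\<close>

definition minorised_by :: "'s::topological_space measure \<Rightarrow> ('s \<Rightarrow> real) \<Rightarrow> 's measure \<Rightarrow> bool" where
  "minorised_by P \<beta> P0 \<longleftrightarrow>
     (\<forall>g B. g \<in> borel_measurable borel \<longrightarrow> (\<forall>x. 0 \<le> g x \<and> g x \<le> B) \<longrightarrow>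
        (\<integral>x. \<beta> x * g x \<partial>P0) \<le> (\<integral>x. g x \<partial>P))"

lemma minorised_byD:
  assumes "minorised_by P \<beta> P0" "g \<in> borel_measurable borel" "\<And>x. 0 \<le> g x" "\<And>x. g x \<le> B"
  shows "(\<integral>x. \<beta> x * g x \<partial>P0) \<le> (\<integral>x. g x \<partial>P)"
  using assms(1)[unfolded minorised_by_def, rule_format, of g B] assms(2-4) by blast

lemma couplingD:
  fixes g :: "'s::topological_space \<Rightarrow> real"
  assumes "coupling P Q C"
  shows "C \<in> space (prob_algebra (borel \<Otimes>\<^sub>M borel))"
    and "g \<in> borel_measurable borel \<Longrightarrow> (\<integral>x. g x \<partial>P) = (\<integral>z. g (fst z) \<partial>C)"
    and "g \<in> borel_measurable borel \<Longrightarrow> (\<integral>x. g x \<partial>Q) = (\<integral>z. g (snd z) \<partial>C)"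
proof -
  show C: "C \<in> space (prob_algebra (borel \<Otimes>\<^sub>M borel))"
    using assms by (simp add: coupling_def)
  have PQ: "P = distr C borel fst" "Q = distr C borel snd"
    using assms by (auto simp: coupling_def)
  have m: "fst \<in> C \<rightarrow>\<^sub>M borel" "snd \<in> C \<rightarrow>\<^sub>M borel"
    using prob_lawD(2)[OF C] by (auto cong: measurable_cong_sets)
  show "(\<integral>x. g x \<partial>P) = (\<integral>z. g (fst z) \<partial>C)" if "g \<in> borel_measurable borel"
    unfolding PQ(1) by (rule integral_distr[OF m(1) that])
  show "(\<integral>x. g x \<partial>Q) = (\<integral>z. g (snd z) \<partial>C)" if "g \<in> borel_measurable borel"
    unfolding PQ(2) by (rule integral_distr[OF m(2) that])
qed

text \<open>The variables \<open>s\<close> and \<open>t\<close> are integrated out one after the other, that is, \<open>P\<close> and \<open>Q\<close> are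
  coupled independently.\<close>

lemma integral_diff_le_osc:
  assumes P: "prob_law P" and Q: "prob_law Q" and h: "unit_fun h" and v: "unit_fun v"
    and osc: "\<And>s t. h s - h t \<le> a + v s + v t"
  shows "(\<integral>x. h x \<partial>P) - (\<integral>x. h x \<partial>Q) \<le> a + (\<integral>x. v x \<partial>P) + (\<integral>x. v x \<partial>Q)"
proof -
  interpret P: prob_space P using P by (rule prob_lawD)
  interpret Q: prob_space Q using Q by (rule prob_lawD)
  note [simp] = integrable_unit_fun[OF P h] integrable_unit_fun[OF P v]
    integrable_unit_fun[OF Q h] integrable_unit_fun[OF Q v]
  have 1: "(\<integral>x. h x \<partial>P) - h t \<le> a + (\<integral>x. v x \<partial>P) + v t" for t
  proof -
    have "(\<integral>s. h s - h t \<partial>P) \<le> (\<integral>s. a + v s + v t \<partial>P)"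
      by (intro integral_mono osc) auto
    then show ?thesis by (simp add: P.prob_space)
  qed
  have "(\<integral>t. (\<integral>x. h x \<partial>P) - h t \<partial>Q) \<le> (\<integral>t. a + (\<integral>x. v x \<partial>P) + v t \<partial>Q)"
    by (intro integral_mono 1) auto
  then show ?thesis by (simp add: Q.prob_space)
qed

text \<open>Where the coupling \<open>C\<close> is accepted on both sides, the sharp bound \<open>w\<close> applies. The mass that is
  left over in \<open>P\<close> and in \<open>Q\<close> is at most the sum of the two deficits \<open>1 - \<integral>\<beta>\<close> and \<open>1 - \<integral>\<gamma>\<close>, and on it
  \<open>osc\<close> applies. The constant \<open>c\<close> in the proof separates the two variables in \<open>osc\<close>: then
  \<open>g1 = v + c + a - h\<close> and \<open>g2 = h + v - c\<close> are nonnegative, so the minorants bound their integrals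
  against \<open>P\<close> and \<open>Q\<close> from below, and \<open>c\<close> cancels in the sum.\<close>

lemma integral_diff_le_minorants:
  assumes P: "prob_law P" and Q: "prob_law Q" and C: "coupling P0 Q0 C"
    and \<beta>: "unit_fun \<beta>" and \<gamma>: "unit_fun \<gamma>"
    and minP: "minorised_by P \<beta> P0" and minQ: "minorised_by Q \<gamma> Q0"
    and h: "unit_fun h" and v: "unit_fun v" and a: "0 \<le> a"
    and osc: "\<And>s t. h s - h t \<le> a + v s + v t"
    and w_int: "integrable C w" and w_nonneg: "\<And>z. 0 \<le> w z"
    and w: "\<And>s t. h s - h t \<le> a * w (s, t) + v s + v t"
  shows "(\<integral>x. h x \<partial>P) - (\<integral>x. h x \<partial>Q)
    \<le> a * ((\<integral>z. w z \<partial>C) + (1 - (\<integral>x. \<beta> x \<partial>P0)) + (1 - (\<integral>x. \<gamma> x \<partial>Q0)))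
      + (\<integral>x. v x \<partial>P) + (\<integral>x. v x \<partial>Q)"
proof -
  interpret P: prob_space P using P by (rule prob_lawD)
  interpret Q: prob_space Q using Q by (rule prob_lawD)
  note CD = couplingD[OF C]
  interpret C: prob_space C using CD(1) by (rule prob_lawD)
  note [measurable] = unit_funD(1)[OF h] unit_funD(1)[OF v] unit_funD(1)[OF \<beta>] unit_funD(1)[OF \<gamma>]
  note [simp] = integrable_unit_fun[OF P h] integrable_unit_fun[OF P v]
    integrable_unit_fun[OF Q h] integrable_unit_fun[OF Q v]
  note bounds = unit_funD(2,3)[OF h] unit_funD(2,3)[OF v] unit_funD(2,3)[OF \<beta>] unit_funD(2,3)[OF \<gamma>]
  define c where "c = (INF t. h t + v t)"
  have bdd: "bdd_below (range (\<lambda>t. h t + v t))"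
    using bounds by (intro bdd_belowI[of _ 0]) (auto intro: add_nonneg_nonneg)
  have c_le: "c \<le> h t + v t" for t
    unfolding c_def by (rule cINF_lower[OF bdd]) simp
  have le_c: "h s - v s - a \<le> c" for s
    unfolding c_def using osc[of s] by (intro cINF_greatest) (auto simp: algebra_simps)
  have c0: "0 \<le> c"
    unfolding c_def using bounds by (intro cINF_greatest) (auto intro: add_nonneg_nonneg)
  have c2: "c \<le> 2"
    using c_le[of undefined] bounds(2)[of undefined] bounds(4)[of undefined] by linarith
  define g1 where "g1 s = v s + c + a - h s" for s
  define g2 where "g2 t = h t + v t - c" for t
  have [measurable]: "g1 \<in> borel_measurable borel" "g2 \<in> borel_measurable borel"
    unfolding g1_def g2_def by measurable
  have g1: "0 \<le> g1 s" "g1 s \<le> 3 + a" for s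
    using le_c[of s] bounds[of s] c2 by (auto simp: g1_def)
  have g2: "0 \<le> g2 s" "g2 s \<le> 3 + a" for s
    using c_le[of s] bounds[of s] c0 a unfolding g2_def by linarith+
  have "(\<integral>z. \<beta> (fst z) * g1 (fst z) \<partial>C) = (\<integral>x. \<beta> x * g1 x \<partial>P0)"
    by (rule CD(2)[symmetric]) measurable
  also have "\<dots> \<le> (\<integral>x. g1 x \<partial>P)"
    using g1 by (intro minorised_byD[OF minP, of _ "3 + a"]) auto
  also have "\<dots> = (\<integral>x. v x \<partial>P) + c + a - (\<integral>x. h x \<partial>P)"
    by (simp add: g1_def P.prob_space)
  finally have 1: "(\<integral>z. \<beta> (fst z) * g1 (fst z) \<partial>C) \<le> (\<integral>x. v x \<partial>P) + c + a - (\<integral>x. h x \<partial>P)" .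
  have "(\<integral>z. \<gamma> (snd z) * g2 (snd z) \<partial>C) = (\<integral>x. \<gamma> x * g2 x \<partial>Q0)"
    by (rule CD(3)[symmetric]) measurable
  also have "\<dots> \<le> (\<integral>x. g2 x \<partial>Q)"
    using g2 by (intro minorised_byD[OF minQ, of _ "3 + a"]) auto
  also have "\<dots> = (\<integral>x. h x \<partial>Q) + (\<integral>x. v x \<partial>Q) - c"
    by (simp add: g2_def Q.prob_space)
  finally have 2: "(\<integral>z. \<gamma> (snd z) * g2 (snd z) \<partial>C) \<le> (\<integral>x. h x \<partial>Q) + (\<integral>x. v x \<partial>Q) - c" .
  \<comment> \<open>\<open>m\<close> is the probability that one uniform variable accepts both proposals.\<close>
  have pointwise: "a * (\<beta> s + \<gamma> t - 1 - w (s, t)) \<le> \<beta> s * g1 s + \<gamma> t * g2 t" for s t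
  proof -
    define m where "m = min (\<beta> s) (\<gamma> t)"
    have m: "0 \<le> m" "m \<le> 1" "m \<le> \<beta> s" "m \<le> \<gamma> t" "\<beta> s + \<gamma> t - 1 \<le> m"
      using bounds[of s] bounds[of t] by (auto simp: m_def)
    have "a * (\<beta> s + \<gamma> t - 1 - w (s, t)) \<le> a * (m - m * w (s, t))"
      using m a w_nonneg[of "(s, t)"] mult_right_mono[of m 1 "w (s, t)"]
      by (intro mult_left_mono) auto
    also have "\<dots> = m * (a - a * w (s, t))"
      by (simp add: algebra_simps)
    also have "\<dots> \<le> m * (g1 s + g2 t)"
      using w[of s t] m by (intro mult_left_mono) (auto simp: g1_def g2_def)
    also have "\<dots> \<le> \<beta> s * g1 s + \<gamma> t * g2 t"
      using mult_right_mono[of m "\<beta> s" "g1 s"] mult_right_mono[of m "\<gamma> t" "g2 t"] m g1 g2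
      by (simp add: distrib_left)
    finally show ?thesis .
  qed
  have int_b: "integrable C (\<lambda>z. \<beta> (fst z))" "integrable C (\<lambda>z. \<gamma> (snd z))"
    using bounds by (auto intro!: integrable_bounded_prob_law[OF CD(1), of _ 1])
  have "\<bar>\<beta> s * g1 s\<bar> \<le> 1 * (3 + a)" for s
    unfolding abs_mult using bounds[of s] g1[of s] by (intro mult_mono) auto
  moreover have "\<bar>\<gamma> s * g2 s\<bar> \<le> 1 * (3 + a)" for s
    unfolding abs_mult using bounds[of s] g2[of s] by (intro mult_mono) auto
  ultimately have int_g: "integrable C (\<lambda>z. \<beta> (fst z) * g1 (fst z))"
    "integrable C (\<lambda>z. \<gamma> (snd z) * g2 (snd z))"
    by (auto intro!: integrable_bounded_prob_law[OF CD(1), of _ "1 * (3 + a)"])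
  have "(\<integral>z. a * (\<beta> (fst z) + \<gamma> (snd z) - 1 - w z) \<partial>C)
      \<le> (\<integral>z. \<beta> (fst z) * g1 (fst z) + \<gamma> (snd z) * g2 (snd z) \<partial>C)"
    using pointwise[of "fst z" "snd z" for z] int_b int_g w_int by (intro integral_mono) auto
  then have "a * ((\<integral>x. \<beta> x \<partial>P0) + (\<integral>x. \<gamma> x \<partial>Q0) - 1 - (\<integral>z. w z \<partial>C))
      \<le> (\<integral>z. \<beta> (fst z) * g1 (fst z) \<partial>C) + (\<integral>z. \<gamma> (snd z) * g2 (snd z) \<partial>C)"
    using int_b int_g w_int by (simp add: C.prob_space CD)
  then show ?thesis using 1 2 by (simp add: algebra_simps)
qed

section \<open>One epoch for a minorised kernel\<close>

text \<open>All that the mixing bound needs to know about an adjusted kernel \<open>K\<close>: with probability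
  \<open>\<alpha> x z\<close> it makes the move to \<open>z\<close> that \<open>Ku x\<close> proposes. What happens after a rejection is left open.\<close>

locale minorised_kernel =
  fixes K Ku :: "'s::{metric_space, second_countable_topology} \<Rightarrow> 's measure"
    and \<alpha> :: "'s \<Rightarrow> 's \<Rightarrow> real" and D :: "'s set" and p :: real
  assumes kernel: "prob_kernel K"
    and unit_\<alpha>: "\<And>x. unit_fun (\<alpha> x)"
    and minorised: "\<And>x. minorised_by (K x) (\<alpha> x) (Ku x)"
    and rejection_le: "\<And>x. x \<in> D \<Longrightarrow> 1 - (\<integral>z. \<alpha> x z \<partial>Ku x) \<le> p"
    and p_nonneg: "0 \<le> p"
    and D_meas: "D \<in> sets borel"
begin

lemma kernel_act_range:
  assumes "unit_fun f"
  shows "0 \<le> kernel_act K f x" "kernel_act K f x \<le> 1"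
  using unit_funD[OF unit_fun_kernel_act[OF kernel assms]] by auto

lemma exit_step_range:
  assumes "unit_fun f"
  shows "0 \<le> exit_step K D f x" "exit_step K D f x \<le> 1"
  using unit_funD[OF unit_fun_exit_step[OF kernel D_meas assms]] by auto

text \<open>Outside \<open>D\<close> the exit term is already \<open>1\<close>, as large as any difference of values of a unit
  function.\<close>

lemma kernel_act_diff_le_outside:
  assumes "unit_fun h" "unit_fun v" "x \<notin> D \<or> y \<notin> D" "0 \<le> b"
  shows "kernel_act K h x - kernel_act K h y \<le> b + exit_step K D v x + exit_step K D v y"
proof -
  have "1 \<le> exit_step K D v x + exit_step K D v y"
    using assms(3) exit_step_range[OF assms(2), of x] exit_step_range[OF assms(2), of y]
    by (auto simp: exit_step_def)
  then show ?thesis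
    using kernel_act_range[OF assms(1), of x] kernel_act_range[OF assms(1), of y] assms(4)
    by linarith
qed

lemma kernel_act_diff_le_osc:
  assumes "unit_fun h" "unit_fun v" "0 \<le> a" "\<And>s t. h s - h t \<le> a + v s + v t"
  shows "kernel_act K h x - kernel_act K h y \<le> a + exit_step K D v x + exit_step K D v y"
proof (cases "x \<in> D \<and> y \<in> D")
  case True
  then show ?thesis
    using integral_diff_le_osc[OF prob_kernelD[OF kernel, of x] prob_kernelD[OF kernel, of y] assms(1,2,4)]
    by (simp add: exit_step_def kernel_act_def)
next
  case False
  then show ?thesis using kernel_act_diff_le_outside[OF assms(1,2) _ assms(3)] by blast
qed

lemma kernel_act_diff_le_coupled:
  assumes D: "x \<in> D" "y \<in> D" and C: "coupling (Ku x) (Ku y) C"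
    and hv: "unit_fun h" "unit_fun v" and a: "0 \<le> a"
    and osc: "\<And>s t. h s - h t \<le> a + v s + v t"
    and w: "integrable C w" "\<And>z. 0 \<le> w z" "\<And>s t. h s - h t \<le> a * w (s, t) + v s + v t"
    and b: "(\<integral>z. w z \<partial>C) \<le> b"
  shows "kernel_act K h x - kernel_act K h y
    \<le> a * (b + 2 * p) + exit_step K D v x + exit_step K D v y"
proof -
  have "kernel_act K h x - kernel_act K h y
    \<le> a * ((\<integral>z. w z \<partial>C) + (1 - (\<integral>z. \<alpha> x z \<partial>Ku x)) + (1 - (\<integral>z. \<alpha> y z \<partial>Ku y)))
      + kernel_act K v x + kernel_act K v y"
    unfolding kernel_act_def
    by (rule integral_diff_le_minorants[OF prob_kernelD[OF kernel] prob_kernelD[OF kernel] C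
          unit_\<alpha> unit_\<alpha> minorised minorised hv a osc w])
  also have "\<dots> \<le> a * (b + 2 * p) + kernel_act K v x + kernel_act K v y"
    using b rejection_le[OF D(1)] rejection_le[OF D(2)] a
    by (intro add_right_mono mult_left_mono) auto
  finally show ?thesis using D by (simp add: exit_step_def)
qed

text \<open>One regularising step followed, in the backward order, by \<open>n\<close> contractive steps. The crude
  bound \<open>oscH\<close> has to be carried along with the sharp bound \<open>coupled\<close>, because every step uses it on
  the rejected part of the mass.\<close>

lemma kernel_act_diff_le_epoch:
  fixes n :: nat
  assumes contr: "\<And>x y. x \<in> D \<Longrightarrow> y \<in> D \<Longrightarrow> \<exists>C. coupling (Ku x) (Ku y) C \<and>
      integrable C (\<lambda>z. dist (fst z) (snd z)) \<and>
      (\<integral>z. dist (fst z) (snd z) \<partial>C) \<le> (1 - \<rho>) * dist x y"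
    and reg: "\<And>x y. x \<in> D \<Longrightarrow> y \<in> D \<Longrightarrow> \<exists>C. coupling (Ku x) (Ku y) C \<and>
      measure C (- Id) \<le> c * dist x y"
    and c: "0 \<le> c"
    and diam: "\<And>x y. x \<in> D \<Longrightarrow> y \<in> D \<Longrightarrow> dist x y \<le> R" and R: "0 \<le> R"
    and hv: "unit_fun h" "unit_fun v" and a: "0 \<le> a"
    and osc: "\<And>s t. h s - h t \<le> a + v s + v t"
  shows "(kernel_act K ^^ Suc n) h x - (kernel_act K ^^ Suc n) h y
    \<le> a * (c * exp (- (\<rho> * real n)) * R + 2 * p * real (Suc n))
      + (exit_step K D ^^ Suc n) v x + (exit_step K D ^^ Suc n) v y"
proof -
  define H where "H j = (kernel_act K ^^ j) h" for j
  define V where "V j = (exit_step K D ^^ j) v" for j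
  have HS: "H (Suc j) = kernel_act K (H j)" and VS: "V (Suc j) = exit_step K D (V j)" for j
    by (simp_all add: H_def V_def)
  have unitH: "unit_fun (H j)" and unitV: "unit_fun (V j)" for j
    unfolding H_def V_def
    using unit_fun_kernel_act_funpow[OF kernel hv(1)]
      unit_fun_exit_step_funpow[OF kernel D_meas hv(2)] by blast+
  have oscH: "H j s - H j t \<le> a + V j s + V j t" for j s t
  proof (induction j arbitrary: s t)
    case 0
    then show ?case using osc by (simp add: H_def V_def)
  next
    case (Suc j)
    then show ?case
      unfolding HS VS by (intro kernel_act_diff_le_osc[OF unitH unitV a])
  qed
  have coupled: "H (Suc j) s - H (Suc j) t
      \<le> a * (c * exp (- (\<rho> * real j)) * dist s t + 2 * p * real (Suc j)) + V (Suc j) s + V (Suc j) t"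
    for j s t
  proof (induction j arbitrary: s t)
    case 0
    show ?case
    proof (cases "s \<in> D \<and> t \<in> D")
      case True
      then obtain C where C: "coupling (Ku s) (Ku t) C" and le: "measure C (- Id) \<le> c * dist s t"
        using reg by blast
      note CD = couplingD(1)[OF C]
      interpret C: prob_space C using CD by (rule prob_lawD)
      have "{z \<in> space (borel \<Otimes>\<^sub>M borel). dist (fst z) (snd z :: 's) \<noteq> 0} \<in> sets (borel \<Otimes>\<^sub>M borel)"
        by measurable
      also have "{z \<in> space (borel \<Otimes>\<^sub>M borel). dist (fst z) (snd z :: 's) \<noteq> 0} = - Id"
        by (auto simp: space_pair_measure)
      finally have Id: "- Id \<in> sets C" using prob_lawD(2)[OF CD] by simp
      have "kernel_act K (H 0) s - kernel_act K (H 0) t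
          \<le> a * (c * dist s t + 2 * p) + exit_step K D (V 0) s + exit_step K D (V 0) t"
      proof (rule kernel_act_diff_le_coupled[OF _ _ C unitH unitV a oscH, where w="indicator (- Id)"])
        show "integrable C (indicat_real (- Id))"
          using Id by (intro integrable_real_indicator) (auto simp: C.emeasure_finite less_top[symmetric])
        show "H 0 s' - H 0 t' \<le> a * indicat_real (- Id) (s', t') + V 0 s' + V 0 t'" for s' t'
          using oscH[of 0 s' t'] unit_funD(2)[OF unitV[of 0]] by (cases "s' = t'") auto
        show "(\<integral>z. indicat_real (- Id) z \<partial>C) \<le> c * dist s t"
          using le Id by simp
      qed (use True in auto)
      then show ?thesis by (simp add: HS VS)
    next
      case False
      then show ?thesis
        unfolding HS VS using a c p_nonneg
        by (intro kernel_act_diff_le_outside[OF unitH unitV]) auto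
    qed
  next
    case (Suc j)
    show ?case
    proof (cases "s \<in> D \<and> t \<in> D")
      case True
      then obtain C where C: "coupling (Ku s) (Ku t) C"
        and int: "integrable C (\<lambda>z. dist (fst z) (snd z))"
        and le: "(\<integral>z. dist (fst z) (snd z) \<partial>C) \<le> (1 - \<rho>) * dist s t"
        using contr by blast
      note CD = couplingD(1)[OF C]
      interpret C: prob_space C using CD by (rule prob_lawD)
      define w where "w z = c * exp (- (\<rho> * real j)) * dist (fst z) (snd z) + 2 * p * real (Suc j)"
        for z :: "'s \<times> 's"
      \<comment> \<open>\<open>exp (- \<rho>)\<close> replaces \<open>1 - \<rho>\<close> as the contraction factor, so that \<open>w\<close> stays nonnegative
        also if \<open>\<rho> > 1\<close>.\<close>
      have "(\<integral>z. dist (fst z) (snd z) \<partial>C) \<le> exp (- \<rho>) * dist s t"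
        using le exp_ge_add_one_self[of "- \<rho>"] mult_right_mono[of "1 - \<rho>" "exp (- \<rho>)" "dist s t"]
        by simp
      then have "c * exp (- (\<rho> * real j)) * (\<integral>z. dist (fst z) (snd z) \<partial>C)
          \<le> c * exp (- (\<rho> * real j)) * (exp (- \<rho>) * dist s t)"
        using c by (intro mult_left_mono) auto
      moreover have "exp (- (\<rho> * real j)) * exp (- \<rho>) = exp (- (\<rho> * real (Suc j)))"
        by (simp add: mult_exp_exp algebra_simps)
      then have "c * exp (- (\<rho> * real j)) * (exp (- \<rho>) * dist s t)
          = c * exp (- (\<rho> * real (Suc j))) * dist s t"
        by (simp only: mult.assoc[symmetric]) (simp add: mult.assoc)
      ultimately have "c * exp (- (\<rho> * real j)) * (\<integral>z. dist (fst z) (snd z) \<partial>C)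
          \<le> c * exp (- (\<rho> * real (Suc j))) * dist s t"
        by (simp only:)
      then have w_le: "(\<integral>z. w z \<partial>C)
          \<le> c * exp (- (\<rho> * real (Suc j))) * dist s t + 2 * p * real (Suc j)"
        using int by (simp add: w_def C.prob_space)
      have "kernel_act K (H (Suc j)) s - kernel_act K (H (Suc j)) t
          \<le> a * (c * exp (- (\<rho> * real (Suc j))) * dist s t + 2 * p * real (Suc j) + 2 * p)
            + exit_step K D (V (Suc j)) s + exit_step K D (V (Suc j)) t"
      proof (rule kernel_act_diff_le_coupled[OF _ _ C unitH unitV a oscH _ _ _ w_le])
        show "integrable C w" unfolding w_def using int by simp
        show "0 \<le> w z" for z using c p_nonneg by (simp add: w_def)
        show "H (Suc j) s' - H (Suc j) t' \<le> a * w (s', t') + V (Suc j) s' + V (Suc j) t'" for s' t'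
          using Suc.IH[of s' t'] by (simp add: w_def)
      qed (use True in auto)
      then show ?thesis
        unfolding HS[of "Suc j"] VS[of "Suc j"] by (simp add: algebra_simps)
    next
      case False
      then show ?thesis
        unfolding HS[of "Suc j"] VS[of "Suc j"] using a c p_nonneg
        by (intro kernel_act_diff_le_outside[OF unitH unitV]) auto
    qed
  qed
  show ?thesis
  proof (cases "x \<in> D \<and> y \<in> D")
    case True
    have "a * (c * exp (- (\<rho> * real n)) * dist x y + 2 * p * real (Suc n))
      \<le> a * (c * exp (- (\<rho> * real n)) * R + 2 * p * real (Suc n))"
      using True diam a c by (intro mult_left_mono add_right_mono) auto
    then show ?thesis using coupled[of n x y] by (simp add: H_def V_def)
  next
    case False
    have "kernel_act K (H n) x - kernel_act K (H n) y
        \<le> a * (c * exp (- (\<rho> * real n)) * R + 2 * p * real (Suc n))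
          + exit_step K D (V n) x + exit_step K D (V n) y"
      using False a c p_nonneg R by (intro kernel_act_diff_le_outside[OF unitH unitV]) auto
    then show ?thesis by (simp add: H_def V_def)
  qed
qed

lemma kernel_act_diff_le_epochs:
  fixes n :: nat
  assumes contr: "\<And>x y. x \<in> D \<Longrightarrow> y \<in> D \<Longrightarrow> \<exists>C. coupling (Ku x) (Ku y) C \<and>
      integrable C (\<lambda>z. dist (fst z) (snd z)) \<and>
      (\<integral>z. dist (fst z) (snd z) \<partial>C) \<le> (1 - \<rho>) * dist x y"
    and reg: "\<And>x y. x \<in> D \<Longrightarrow> y \<in> D \<Longrightarrow> \<exists>C. coupling (Ku x) (Ku y) C \<and>
      measure C (- Id) \<le> c * dist x y"
    and c: "0 \<le> c"
    and diam: "\<And>x y. x \<in> D \<Longrightarrow> y \<in> D \<Longrightarrow> dist x y \<le> R" and R: "0 \<le> R"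
    and factor: "c * exp (- (\<rho> * real n)) * R + 2 * p * real (Suc n) \<le> exp (- 1)"
    and f: "unit_fun f"
  shows "(kernel_act K ^^ (Suc n * k)) f x - (kernel_act K ^^ (Suc n * k)) f y
    \<le> exp (- real k) + (exit_step K D ^^ (Suc n * k)) (\<lambda>_. 0) x
      + (exit_step K D ^^ (Suc n * k)) (\<lambda>_. 0) y"
proof (induction k arbitrary: x y)
  case 0
  then show ?case using unit_funD(2,3)[OF f, of x] unit_funD(2,3)[OF f, of y] by simp
next
  case (Suc k)
  have unit0: "unit_fun (\<lambda>_::'s. 0)" by (simp add: unit_fun_def)
  define H where "H = (kernel_act K ^^ (Suc n * k)) f"
  define V where "V = (exit_step K D ^^ (Suc n * k)) (\<lambda>_. 0)"
  have "(kernel_act K ^^ Suc n) H x - (kernel_act K ^^ Suc n) H y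
      \<le> exp (- real k) * (c * exp (- (\<rho> * real n)) * R + 2 * p * real (Suc n))
        + (exit_step K D ^^ Suc n) V x + (exit_step K D ^^ Suc n) V y"
    using Suc.IH unit_fun_kernel_act_funpow[OF kernel f] unit_fun_exit_step_funpow[OF kernel D_meas unit0]
    by (intro kernel_act_diff_le_epoch[OF contr reg c diam R]) (auto simp: H_def V_def)
  also have "\<dots> \<le> exp (- real k) * exp (- 1) + (exit_step K D ^^ Suc n) V x + (exit_step K D ^^ Suc n) V y"
    using factor by (intro add_right_mono mult_left_mono) auto
  also have "exp (- real k) * exp (- 1) = exp (- real (Suc k))"
    by (simp add: mult_exp_exp)
  also have "(kernel_act K ^^ Suc n) H = (kernel_act K ^^ (Suc n * Suc k)) f"
    by (simp only: H_def mult_Suc_right funpow_add o_apply)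
  also have "(exit_step K D ^^ Suc n) V = (exit_step K D ^^ (Suc n * Suc k)) (\<lambda>_. 0)"
    by (simp only: V_def mult_Suc_right funpow_add o_apply)
  finally show ?case .
qed

end

section \<open>The adjusted kernel\<close>

lemma measure_uniform_atMost:
  fixes q :: real
  assumes "0 \<le> q" "q \<le> 1"
  shows "measure (uniform_measure lborel {0<..<1}) {..q} = q"
proof -
  have "measure lborel ({0<..<1} \<inter> {..q}) = q"
  proof (cases "q = 1")
    case True
    then have "{0<..<1} \<inter> {..q} = {0<..<1}" by auto
    then show ?thesis using True by simp
  next
    case False
    then have "{0<..<1} \<inter> {..q} = {0<..q}" using assms by auto
    then show ?thesis using assms by simp
  qed
  then show ?thesis by simp
qed

text \<open>By independence the pair \<open>(U, Z)\<close> has a product law. Integrating out \<open>U\<close> first replaces the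
  acceptance event by its conditional probability \<open>q z\<close> given \<open>Z = z\<close>.\<close>

lemma integral_accepted:
  fixes U :: "'w \<Rightarrow> real" and Z :: "'w \<Rightarrow> 's::topological_space"
  assumes M: "prob_space M"
    and [measurable]: "U \<in> M \<rightarrow>\<^sub>M borel" "Z \<in> M \<rightarrow>\<^sub>M borel"
    and law: "distr M borel U = uniform_measure lborel {0<..<1}"
    and indep: "\<And>A B. A \<in> sets borel \<Longrightarrow> B \<in> sets borel \<Longrightarrow>
      measure M ((U -` A \<inter> space M) \<inter> (Z -` B \<inter> space M))
        = measure M (U -` A \<inter> space M) * measure M (Z -` B \<inter> space M)"
    and q: "unit_fun q" and g: "g \<in> borel_measurable borel" "\<And>x. 0 \<le> g x" "\<And>x. g x \<le> B"
  shows "(\<integral>\<omega>. indicator {\<omega> \<in> space M. U \<omega> \<le> q (Z \<omega>)} \<omega> * g (Z \<omega>) \<partial>M)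
    = (\<integral>z. q z * g z \<partial>distr M borel Z)"
proof -
  interpret M: prob_space M by fact
  note [measurable] = unit_funD(1)[OF q] g(1)
  let ?U = "distr M borel U" and ?Z = "distr M borel Z"
  interpret U: prob_space ?U by (rule M.prob_space_distr) simp
  interpret Z: prob_space ?Z by (rule M.prob_space_distr) simp
  interpret UZ: pair_prob_space ?U ?Z ..
  have joint: "?U \<Otimes>\<^sub>M ?Z = distr M (borel \<Otimes>\<^sub>M borel) (\<lambda>\<omega>. (U \<omega>, Z \<omega>))"
  proof (rule pair_measure_eqI)
    fix A B assume AB: "A \<in> sets ?U" "B \<in> sets ?Z"
    then have [measurable]: "A \<in> sets borel" "B \<in> sets borel" by auto
    have "emeasure ?U A * emeasure ?Z B
        = ennreal (measure M (U -` A \<inter> space M) * measure M (Z -` B \<inter> space M))"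
      by (simp add: emeasure_distr M.emeasure_eq_measure ennreal_mult)
    also have "\<dots> = emeasure M ((U -` A \<inter> space M) \<inter> (Z -` B \<inter> space M))"
      by (simp add: indep M.emeasure_eq_measure)
    also have "(U -` A \<inter> space M) \<inter> (Z -` B \<inter> space M) = (\<lambda>\<omega>. (U \<omega>, Z \<omega>)) -` (A \<times> B) \<inter> space M"
      by auto
    also have "emeasure M \<dots> = emeasure (distr M (borel \<Otimes>\<^sub>M borel) (\<lambda>\<omega>. (U \<omega>, Z \<omega>))) (A \<times> B)"
      by (subst emeasure_distr) auto
    finally show "emeasure ?U A * emeasure ?Z B
        = emeasure (distr M (borel \<Otimes>\<^sub>M borel) (\<lambda>\<omega>. (U \<omega>, Z \<omega>))) (A \<times> B)" .
  qed (simp_all add: U.sigma_finite_measure_axioms Z.sigma_finite_measure_axioms cong: sets_pair_measure_cong)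
  define f where "f u z = indicator {..q z} u * g z" for u z
  have f_meas: "(\<lambda>(u, z). f u z) \<in> borel_measurable (borel \<Otimes>\<^sub>M borel)"
    unfolding f_def indicator_def by (simp add: Collect_conv_if) measurable
  have f_bound: "\<bar>f u z\<bar> \<le> B" for u z
    using g(2,3)[of z] by (auto simp: f_def indicator_def intro: order_trans)
  have sets_UZ: "sets (?U \<Otimes>\<^sub>M ?Z) = sets (borel \<Otimes>\<^sub>M borel)"
    by (simp cong: sets_pair_measure_cong)
  have f_int: "integrable (?U \<Otimes>\<^sub>M ?Z) (\<lambda>(u, z). f u z)"
    using f_meas f_bound
    by (intro UZ.P.integrable_const_bound[of _ B]) (auto simp: sets_UZ cong: measurable_cong_sets)
  have "(\<integral>\<omega>. indicator {\<omega> \<in> space M. U \<omega> \<le> q (Z \<omega>)} \<omega> * g (Z \<omega>) \<partial>M)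
      = (\<integral>\<omega>. (\<lambda>(u, z). f u z) (U \<omega>, Z \<omega>) \<partial>M)"
    by (intro Bochner_Integration.integral_cong) (auto simp: f_def indicator_def)
  also have "\<dots> = (\<integral>z. (\<lambda>(u, z). f u z) z \<partial>(?U \<Otimes>\<^sub>M ?Z))"
    unfolding joint by (rule integral_distr[symmetric]) (use f_meas in auto)
  also have "\<dots> = (\<integral>z. (\<integral>u. f u z \<partial>?U) \<partial>?Z)"
    using UZ.integral_snd[OF f_int] by simp
  also have "\<dots> = (\<integral>z. q z * g z \<partial>?Z)"
  proof (intro Bochner_Integration.integral_cong refl)
    fix z
    have "(\<integral>u. f u z \<partial>?U) = measure ?U {..q z} * g z"
      by (simp add: f_def)
    also have "measure ?U {..q z} = q z"
      unfolding law by (rule measure_uniform_atMost[OF unit_funD(2,3)[OF q]])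
    finally show "(\<integral>u. f u z \<partial>?U) = q z * g z" .
  qed
  finally show ?thesis .
qed

context
  fixes M :: "'w measure" and U :: "'w \<Rightarrow> real"
    and \<alpha> :: "'s::{metric_space, second_countable_topology} \<Rightarrow> 's \<Rightarrow> real"
    and \<Phi> \<Psi> :: "'w \<Rightarrow> 's \<Rightarrow> 's"
  assumes M: "prob_space M"
    and U_meas [measurable]: "U \<in> M \<rightarrow>\<^sub>M borel"
    and \<alpha>_meas: "(\<lambda>(x, y). \<alpha> x y) \<in> borel \<Otimes>\<^sub>M borel \<rightarrow>\<^sub>M borel"
    and \<alpha>_range: "\<And>x y. 0 \<le> \<alpha> x y \<and> \<alpha> x y \<le> 1"
    and \<Phi>_meas: "(\<lambda>(\<omega>, x). \<Phi> \<omega> x) \<in> M \<Otimes>\<^sub>M borel \<rightarrow>\<^sub>M borel"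
    and \<Psi>_meas: "(\<lambda>(\<omega>, x). \<Psi> \<omega> x) \<in> M \<Otimes>\<^sub>M borel \<rightarrow>\<^sub>M borel"
begin

lemma proposal_measurable:
  "(\<lambda>\<omega>. \<Phi> \<omega> x) \<in> M \<rightarrow>\<^sub>M borel" "(\<lambda>\<omega>. \<Psi> \<omega> x) \<in> M \<rightarrow>\<^sub>M borel"
  using measurable_compose[OF measurable_Pair2' \<Phi>_meas, of x]
    measurable_compose[OF measurable_Pair2' \<Psi>_meas, of x] by simp_all

lemma unit_fun_acceptance: "unit_fun (\<alpha> x)"
  using \<alpha>_range measurable_compose[OF measurable_Pair1' \<alpha>_meas, of x] by (simp add: unit_fun_def)

lemma accept_event_measurable: "accept_event M U \<alpha> \<Phi> x \<in> sets M"
proof -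
  note [measurable] = proposal_measurable unit_funD(1)[OF unit_fun_acceptance]
  show ?thesis unfolding accept_event_def by measurable
qed

lemma adjusted_step_measurable:
  "(\<lambda>(x, \<omega>). adjusted_step M U \<alpha> \<Phi> \<Psi> x \<omega>) \<in> borel \<Otimes>\<^sub>M M \<rightarrow>\<^sub>M borel"
proof -
  have [measurable]: "(\<lambda>z. \<Phi> (snd z) (fst z)) \<in> borel \<Otimes>\<^sub>M M \<rightarrow>\<^sub>M borel"
    "(\<lambda>z. \<Psi> (snd z) (fst z)) \<in> borel \<Otimes>\<^sub>M M \<rightarrow>\<^sub>M borel"
    using measurable_compose[OF measurable_pair_swap' \<Phi>_meas]
      measurable_compose[OF measurable_pair_swap' \<Psi>_meas] by (simp_all add: case_prod_beta')
  have [measurable]: "(\<lambda>z. \<alpha> (fst z) (\<Phi> (snd z) (fst z))) \<in> borel_measurable (borel \<Otimes>\<^sub>M M)"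
    using measurable_compose[of "\<lambda>z. (fst z, \<Phi> (snd z) (fst z))" "borel \<Otimes>\<^sub>M M" "borel \<Otimes>\<^sub>M borel", OF _ \<alpha>_meas]
    by simp
  have "(\<lambda>z. if U (snd z) \<le> \<alpha> (fst z) (\<Phi> (snd z) (fst z)) then \<Phi> (snd z) (fst z) else \<Psi> (snd z) (fst z))
      \<in> borel \<Otimes>\<^sub>M M \<rightarrow>\<^sub>M borel"
    by measurable
  then show ?thesis
    by (rule subst[OF measurable_cong, rotated -1])
      (auto simp: adjusted_step_def accept_event_def space_pair_measure)
qed

lemma prob_kernel_adjusted_kernel: "prob_kernel (adjusted_kernel M U \<alpha> \<Phi> \<Psi>)"
  unfolding adjusted_kernel_def[abs_def]
proof (rule measurable_distr_prob_space2)
  show "(\<lambda>x. M) \<in> borel \<rightarrow>\<^sub>M prob_algebra M"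
    using M by (intro measurable_const) (simp add: space_prob_algebra)
qed (rule adjusted_step_measurable)

lemma integral_accept_event:
  assumes U_law: "distr M borel U = uniform_measure lborel {0<..<1}"
    and indep: "indep_rv M borel U (borel \<Otimes>\<^sub>M borel) (\<lambda>\<omega>. (\<Phi> \<omega> x, \<Psi> \<omega> x))"
    and g: "g \<in> borel_measurable borel" "\<And>z. 0 \<le> g z" "\<And>z. g z \<le> B"
  shows "(\<integral>\<omega>. indicator (accept_event M U \<alpha> \<Phi> x) \<omega> * g (\<Phi> \<omega> x) \<partial>M)
    = (\<integral>z. \<alpha> x z * g z \<partial>distr M borel (\<lambda>\<omega>. \<Phi> \<omega> x))"
  unfolding accept_event_def
proof (rule integral_accepted[OF M U_meas proposal_measurable(1) U_law _ unit_fun_acceptance g])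
  interpret prob_space M by (rule M)
  fix A :: "real set" and B :: "'s set"
  assume A: "A \<in> sets borel" and B: "B \<in> sets borel"
  have "(\<lambda>\<omega>. (\<Phi> \<omega> x, \<Psi> \<omega> x)) -` (B \<times> UNIV) \<inter> space M
      \<in> sets (vimage_algebra (space M) (\<lambda>\<omega>. (\<Phi> \<omega> x, \<Psi> \<omega> x)) (borel \<Otimes>\<^sub>M borel))"
    using B by (intro in_vimage_algebra pair_measureI) auto
  moreover have "(\<lambda>\<omega>. (\<Phi> \<omega> x, \<Psi> \<omega> x)) -` (B \<times> UNIV) \<inter> space M = (\<lambda>\<omega>. \<Phi> \<omega> x) -` B \<inter> space M"
    by auto
  ultimately show "prob ((U -` A \<inter> space M) \<inter> ((\<lambda>\<omega>. \<Phi> \<omega> x) -` B \<inter> space M))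
      = prob (U -` A \<inter> space M) * prob ((\<lambda>\<omega>. \<Phi> \<omega> x) -` B \<inter> space M)"
    using indep_setD[OF indep[unfolded indep_rv_def] in_vimage_algebra[OF A]] by simp
qed

text \<open>Dropping the rejected steps, on which \<open>\<Psi>\<close> is used, only decreases the integral of a nonnegative
  function.\<close>

lemma minorised_by_adjusted_kernel:
  assumes U_law: "distr M borel U = uniform_measure lborel {0<..<1}"
    and indep: "indep_rv M borel U (borel \<Otimes>\<^sub>M borel) (\<lambda>\<omega>. (\<Phi> \<omega> x, \<Psi> \<omega> x))"
  shows "minorised_by (adjusted_kernel M U \<alpha> \<Phi> \<Psi> x) (\<alpha> x) (distr M borel (\<lambda>\<omega>. \<Phi> \<omega> x))"
  unfolding minorised_by_def
proof (intro allI impI)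
  interpret prob_space M by (rule M)
  fix g :: "'s \<Rightarrow> real" and B
  assume g [measurable]: "g \<in> borel_measurable borel" and range: "\<forall>x. 0 \<le> g x \<and> g x \<le> B"
  note [measurable] = proposal_measurable accept_event_measurable
  have [measurable]: "adjusted_step M U \<alpha> \<Phi> \<Psi> x \<in> M \<rightarrow>\<^sub>M borel"
    using measurable_compose[OF measurable_Pair1' adjusted_step_measurable, of x] by simp
  have "(\<integral>z. \<alpha> x z * g z \<partial>distr M borel (\<lambda>\<omega>. \<Phi> \<omega> x))
      = (\<integral>\<omega>. indicator (accept_event M U \<alpha> \<Phi> x) \<omega> * g (\<Phi> \<omega> x) \<partial>M)"
    using range by (intro integral_accept_event[OF U_law indep g, symmetric, of B]) auto
  also have "\<dots> \<le> (\<integral>\<omega>. g (adjusted_step M U \<alpha> \<Phi> \<Psi> x \<omega>) \<partial>M)"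
  proof (rule integral_mono)
    show "integrable M (\<lambda>\<omega>. indicator (accept_event M U \<alpha> \<Phi> x) \<omega> * g (\<Phi> \<omega> x))"
      using range by (intro integrable_const_bound[of _ B]) (auto simp: indicator_def intro: order_trans)
    show "integrable M (\<lambda>\<omega>. g (adjusted_step M U \<alpha> \<Phi> \<Psi> x \<omega>))"
      using range by (intro integrable_const_bound[of _ B]) auto
  qed (use range in \<open>auto simp: adjusted_step_def indicator_def\<close>)
  also have "\<dots> = (\<integral>z. g z \<partial>adjusted_kernel M U \<alpha> \<Phi> \<Psi> x)"
    unfolding adjusted_kernel_def by (rule integral_distr[symmetric]) measurable
  finally show "(\<integral>z. \<alpha> x z * g z \<partial>distr M borel (\<lambda>\<omega>. \<Phi> \<omega> x))
      \<le> (\<integral>z. g z \<partial>adjusted_kernel M U \<alpha> \<Phi> \<Psi> x)" .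
qed

lemma rejection_prob_eq:
  assumes U_law: "distr M borel U = uniform_measure lborel {0<..<1}"
    and indep: "indep_rv M borel U (borel \<Otimes>\<^sub>M borel) (\<lambda>\<omega>. (\<Phi> \<omega> x, \<Psi> \<omega> x))"
  shows "measure M (space M - accept_event M U \<alpha> \<Phi> x)
    = 1 - (\<integral>z. \<alpha> x z \<partial>distr M borel (\<lambda>\<omega>. \<Phi> \<omega> x))"
proof -
  interpret prob_space M by (rule M)
  have "measure M (accept_event M U \<alpha> \<Phi> x) = (\<integral>z. \<alpha> x z \<partial>distr M borel (\<lambda>\<omega>. \<Phi> \<omega> x))"
    using integral_accept_event[OF U_law indep, of "\<lambda>_. 1" 1] accept_event_measurable[of x] by simp
  then show ?thesis using prob_compl[OF accept_event_measurable] by simp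
qed

end

section \<open>Exit probabilities of the Markov chain\<close>

lemma natural_filtration_sets:
  "i \<le> n \<Longrightarrow> B \<in> sets borel \<Longrightarrow> X i -` B \<inter> space N \<in> sets (natural_filtration N X n)"
  unfolding natural_filtration_def by (subst sets_measure_of) (auto intro!: sigma_sets.Basic)

lemma subalgebra_natural_filtration:
  assumes "\<And>i. X i \<in> N \<rightarrow>\<^sub>M borel"
  shows "subalgebra N (natural_filtration N X n)"
proof -
  let ?G = "\<Union>i\<le>n. {X i -` B \<inter> space N |B. B \<in> sets borel}"
  have G: "?G \<subseteq> sets N"
    using measurable_sets[OF assms] by auto
  moreover have "?G \<subseteq> Pow (space N)" by auto
  ultimately show ?thesis
    unfolding subalgebra_def natural_filtration_def
    using sets.sigma_sets_subset[OF G] by (simp add: space_measure_of sets_measure_of)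
qed

text \<open>The Markov property is given through conditional probabilities of single events. Restricted to
  \<open>G\<close>, it identifies the law of \<open>X (Suc j)\<close> as the image of the law of \<open>X j\<close> under \<open>K\<close>, which
  extends it to functions \<open>f\<close>.\<close>

lemma markov_chain_kernel_act:
  assumes chain: "markov_chain N X K \<eta>" and K: "prob_kernel K"
    and G: "G \<in> sets (natural_filtration N X j)" and f: "unit_fun f"
  shows "(\<integral>\<omega>. indicator G \<omega> * f (X (Suc j) \<omega>) \<partial>N)
    = (\<integral>\<omega>. indicator G \<omega> * kernel_act K f (X j \<omega>) \<partial>N)"
proof -
  interpret prob_space N using chain by (simp add: markov_chain_def)
  have X [measurable]: "X i \<in> N \<rightarrow>\<^sub>M borel" for i
    using chain by (simp add: markov_chain_def)
  let ?F = "natural_filtration N X j"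
  interpret F: finite_measure_subalgebra N ?F
    by unfold_locales (rule subalgebra_natural_filtration[OF X])
  have G_N [measurable]: "G \<in> sets N"
    using G F.subalg by (auto simp: subalgebra_def)
  note [measurable] = unit_funD(1)[OF f] unit_funD(1)[OF unit_fun_kernel_act[OF K f]]
  have K_sub [measurable]: "K \<in> borel \<rightarrow>\<^sub>M subprob_algebra borel"
    by (rule measurable_prob_algebraD[OF K])
  define L where "L = density N (indicator G)"
  have sets_L: "sets L = sets N" and space_L: "space L = space N" by (simp_all add: L_def)
  have X_L [measurable]: "X i \<in> L \<rightarrow>\<^sub>M borel" for i
    using X by (simp add: sets_L cong: measurable_cong_sets)
  have nn_L: "(\<integral>\<^sup>+\<omega>. g \<omega> \<partial>L) = (\<integral>\<^sup>+\<omega>. indicator G \<omega> * g \<omega> \<partial>N)" if "g \<in> borel_measurable N" for g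
    using that unfolding L_def by (intro nn_integral_density) auto
  have int_L: "(\<integral>\<omega>. g \<omega> \<partial>L) = (\<integral>\<omega>. indicator G \<omega> * g \<omega> \<partial>N)"
    if [measurable]: "g \<in> borel_measurable N" for g :: "_ \<Rightarrow> real"
  proof -
    have "L = density N (\<lambda>\<omega>. ennreal (indicator G \<omega>))"
      unfolding L_def by (intro density_cong) (auto split: split_indicator)
    then show ?thesis by (simp only:) (subst integral_density; simp)
  qed
  have "finite_measure L"
  proof
    have "emeasure L (space L) = emeasure N G"
      unfolding L_def by (subst emeasure_density) (auto simp: nn_integral_indicator[symmetric] simp del: nn_integral_indicator intro!: nn_integral_cong split: split_indicator)
    then show "emeasure L (space L) \<noteq> \<infinity>" by simp
  qed
  then have fin: "finite_measure (distr L borel (X j))"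
    by (rule finite_measure.finite_measure_distr) simp
  have law: "distr L borel (X (Suc j)) = distr L borel (X j) \<bind> K"
  proof (rule measure_eqI)
    show "sets (distr L borel (X (Suc j))) = sets (distr L borel (X j) \<bind> K)"
      using sets_bind[of "distr L borel (X j)" K borel] prob_lawD(2)[OF prob_kernelD[OF K]] by simp
  next
    fix B assume "B \<in> sets (distr L borel (X (Suc j)))"
    then have B [measurable]: "B \<in> sets borel" by simp
    let ?Y = "X (Suc j) -` B \<inter> space N"
    have Y [measurable]: "?Y \<in> sets N" by measurable
    have mK [measurable]: "(\<lambda>x. measure (K x) B) \<in> borel_measurable borel"
      by (rule measure_measurable_prob_algebra2[where N=borel]) (use K in auto)
    have "emeasure (distr L borel (X (Suc j))) B = emeasure L ?Y"
      by (simp add: emeasure_distr space_L)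
    also have "\<dots> = (\<integral>\<^sup>+\<omega>. ennreal (indicator G \<omega> * indicator ?Y \<omega>) \<partial>N)"
      unfolding L_def by (subst emeasure_density) (auto intro!: nn_integral_cong split: split_indicator)
    also have "\<dots> = ennreal (\<integral>\<omega>. indicator G \<omega> * indicator ?Y \<omega> \<partial>N)"
      by (intro nn_integral_eq_integral integrable_const_bound[of _ 1]) (auto split: split_indicator)
    also have "(\<integral>\<omega>. indicator G \<omega> * indicator ?Y \<omega> \<partial>N)
        = (\<integral>\<omega>. indicator G \<omega> * real_cond_exp N ?F (indicator ?Y) \<omega> \<partial>N)"
      using F.real_cond_exp_intA[OF _ G, of "indicator ?Y"]
      by (simp add: set_lebesgue_integral_def emeasure_finite less_top[symmetric])
    also have "\<dots> = (\<integral>\<omega>. indicator G \<omega> * measure (K (X j \<omega>)) B \<partial>N)"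
    proof (rule integral_cong_AE)
      have "AE \<omega> in N. real_cond_exp N ?F (indicator ?Y) \<omega> = measure (K (X j \<omega>)) B"
        using chain B by (simp add: markov_chain_def)
      then show "AE \<omega> in N. indicator G \<omega> * real_cond_exp N ?F (indicator ?Y) \<omega>
          = indicator G \<omega> * measure (K (X j \<omega>)) B"
        by eventually_elim simp
    qed measurable
    also have "ennreal \<dots> = (\<integral>\<^sup>+\<omega>. ennreal (indicator G \<omega> * measure (K (X j \<omega>)) B) \<partial>N)"
      using prob_space.prob_le_1[OF prob_lawD(1)[OF prob_kernelD[OF K]]]
      by (intro nn_integral_eq_integral[symmetric] integrable_const_bound[of _ 1]) (auto split: split_indicator)
    also have "\<dots> = (\<integral>\<^sup>+\<omega>. indicator G \<omega> * emeasure (K (X j \<omega>)) B \<partial>N)"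
      using finite_measure.emeasure_eq_measure[OF prob_space.finite_measure[OF prob_lawD(1)[OF prob_kernelD[OF K]]]]
      by (intro nn_integral_cong) (auto split: split_indicator)
    also have "\<dots> = (\<integral>\<^sup>+\<omega>. emeasure (K (X j \<omega>)) B \<partial>L)"
      by (rule nn_L[symmetric]) measurable
    also have "\<dots> = (\<integral>\<^sup>+x. emeasure (K x) B \<partial>distr L borel (X j))"
      by (rule nn_integral_distr[symmetric]) measurable
    also have "\<dots> = emeasure (distr L borel (X j) \<bind> K) B"
      by (rule emeasure_bind[symmetric, where N=borel]) (use K_sub in auto)
    finally show "emeasure (distr L borel (X (Suc j))) B = emeasure (distr L borel (X j) \<bind> K) B" .
  qed
  have "(\<integral>\<omega>. indicator G \<omega> * f (X (Suc j) \<omega>) \<partial>N) = (\<integral>\<omega>. f (X (Suc j) \<omega>) \<partial>L)"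
    by (rule int_L[symmetric]) measurable
  also have "\<dots> = (\<integral>x. f x \<partial>distr L borel (X (Suc j)))"
    by (rule integral_distr[symmetric]) measurable
  also have "\<dots> = (\<integral>x. kernel_act K f x \<partial>distr L borel (X j))"
    unfolding law by (rule integral_bind_kernel[OF K fin _ f]) simp
  also have "\<dots> = (\<integral>\<omega>. kernel_act K f (X j \<omega>) \<partial>L)"
    by (rule integral_distr) measurable
  also have "\<dots> = (\<integral>\<omega>. indicator G \<omega> * kernel_act K f (X j \<omega>) \<partial>N)"
    by (rule int_L) measurable
  finally show ?thesis .
qed

text \<open>The proof works with the survival probabilities \<open>s m = 1 - u m\<close> because they obey a product
  recursion, \<open>s (Suc m) = 1\<^sub>D \<cdot> K (s m)\<close>. By the Markov property, surviving up to time \<open>j\<close> and then for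
  \<open>m\<close> more steps from \<open>X j\<close> has the same probability for all \<open>j\<close> with the same \<open>j + m\<close>.\<close>

lemma integral_exit_step_funpow:
  assumes chain: "markov_chain N X K \<eta>" and K: "prob_kernel K" and D [measurable]: "D \<in> sets borel"
  shows "(\<integral>x. (exit_step K D ^^ n) (\<lambda>_. 0) x \<partial>\<eta>) = measure N {\<omega> \<in> space N. \<exists>k<n. X k \<omega> \<notin> D}"
proof -
  interpret prob_space N using chain by (simp add: markov_chain_def)
  have X [measurable]: "X i \<in> N \<rightarrow>\<^sub>M borel" for i
    using chain by (simp add: markov_chain_def)
  have \<eta>: "\<eta> = distr N borel (X 0)"
    using chain by (simp add: markov_chain_def)
  have unit0: "unit_fun (\<lambda>_::'b. 0)" by (simp add: unit_fun_def)
  define u where "u m = (exit_step K D ^^ m) (\<lambda>_. 0)" for m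
  define s where "s m x = 1 - u m x" for m x
  have unit_u: "unit_fun (u m)" for m
    unfolding u_def by (rule unit_fun_exit_step_funpow[OF K D unit0])
  have unit_s: "unit_fun (s m)" for m
    using unit_u[of m] by (auto simp: unit_fun_def s_def[abs_def])
  have s_Suc: "s (Suc m) x = indicator D x * kernel_act K (s m) x" for m x
  proof -
    interpret Kx: prob_space "K x" by (rule prob_lawD(1)[OF prob_kernelD[OF K]])
    have "kernel_act K (s m) x = 1 - kernel_act K (u m) x"
      using integrable_unit_fun[OF prob_kernelD[OF K] unit_u, of x m]
      by (simp add: kernel_act_def s_def Kx.prob_space)
    moreover have "u (Suc m) x = exit_step K D (u m) x" by (simp add: u_def)
    ultimately show ?thesis by (simp add: s_def exit_step_def)
  qed
  note [measurable] = unit_funD(1)[OF unit_u]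
  define G where "G j = {\<omega> \<in> space N. \<forall>i<j. X i \<omega> \<in> D}" for j
  have G_meas [measurable]: "G j \<in> sets N" for j
    unfolding G_def by measurable
  have G_adapted: "G (Suc j) \<in> sets (natural_filtration N X j)" for j
  proof -
    have "(\<Inter>i\<in>{..j}. X i -` D \<inter> space N) \<in> sets (natural_filtration N X j)"
      by (intro sets.finite_INT natural_filtration_sets) auto
    also have "(\<Inter>i\<in>{..j}. X i -` D \<inter> space N) = G (Suc j)"
      by (auto simp: G_def less_Suc_eq_le)
    finally show ?thesis .
  qed
  have stay: "(\<integral>\<omega>. indicator (G j) \<omega> * s m (X j \<omega>) \<partial>N) = measure N (G (j + m))" for j m
  proof (induction m arbitrary: j)
    case 0
    then show ?case by (simp add: s_def u_def)
  next
    case (Suc m)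
    have "(\<integral>\<omega>. indicator (G j) \<omega> * s (Suc m) (X j \<omega>) \<partial>N)
        = (\<integral>\<omega>. indicator (G (Suc j)) \<omega> * kernel_act K (s m) (X j \<omega>) \<partial>N)"
      by (intro Bochner_Integration.integral_cong)
        (auto simp: s_Suc G_def less_Suc_eq split: split_indicator)
    also have "\<dots> = (\<integral>\<omega>. indicator (G (Suc j)) \<omega> * s m (X (Suc j) \<omega>) \<partial>N)"
      by (rule markov_chain_kernel_act[OF chain K G_adapted unit_s, symmetric])
    also have "\<dots> = measure N (G (Suc j + m))" by (rule Suc.IH)
    finally show ?case by simp
  qed
  have int_u: "integrable N (\<lambda>\<omega>. u n (X 0 \<omega>))"
    using unit_funD(2,3)[OF unit_u] by (intro integrable_const_bound[of _ 1]) auto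
  have "(\<integral>x. u n x \<partial>\<eta>) = (\<integral>\<omega>. u n (X 0 \<omega>) \<partial>N)"
    unfolding \<eta> by (rule integral_distr) measurable
  also have "\<dots> = 1 - (\<integral>\<omega>. s n (X 0 \<omega>) \<partial>N)"
    using int_u by (simp add: s_def prob_space)
  also have "(\<integral>\<omega>. s n (X 0 \<omega>) \<partial>N) = (\<integral>\<omega>. indicator (G 0) \<omega> * s n (X 0 \<omega>) \<partial>N)"
    by (intro Bochner_Integration.integral_cong) (auto simp: G_def)
  also have "\<dots> = measure N (G n)" using stay[of 0 n] by simp
  also have "1 - \<dots> = measure N (space N - G n)" by (simp add: prob_compl)
  also have "space N - G n = {\<omega> \<in> space N. \<exists>k<n. X k \<omega> \<notin> D}" by (auto simp: G_def)
  finally show ?thesis by (simp add: u_def)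
qed

lemma exit_time_le_iff: "exit_time X D \<omega> \<le> enat n \<longleftrightarrow> (\<exists>k\<le>n. X k \<omega> \<notin> D)"
proof
  assume le: "exit_time X D \<omega> \<le> enat n"
  show "\<exists>k\<le>n. X k \<omega> \<notin> D"
  proof (rule ccontr)
    assume "\<not> ?thesis"
    then have "enat (Suc n) \<le> exit_time X D \<omega>"
      unfolding exit_time_def by (intro INF_greatest) (auto simp: not_less_eq_eq[symmetric])
    then have "enat (Suc n) \<le> enat n" using le by (rule order_trans)
    then show False by simp
  qed
next
  assume "\<exists>k\<le>n. X k \<omega> \<notin> D"
  then obtain k where k: "k \<le> n" "X k \<omega> \<notin> D" by blast
  have "exit_time X D \<omega> \<le> enat k"
    unfolding exit_time_def using k by (intro INF_lower) simp
  also have "\<dots> \<le> enat n" using k by simp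
  finally show "exit_time X D \<omega> \<le> enat n" .
qed

lemma integral_exit_step_funpow_le:
  assumes chain: "markov_chain N X K \<eta>" and K: "prob_kernel K" and D [measurable]: "D \<in> sets borel"
  shows "(\<integral>x. (exit_step K D ^^ n) (\<lambda>_. 0) x \<partial>\<eta>)
    \<le> measure N {\<omega> \<in> space N. exit_time X D \<omega> \<le> enat n}"
proof -
  interpret prob_space N using chain by (simp add: markov_chain_def)
  have X [measurable]: "X i \<in> N \<rightarrow>\<^sub>M borel" for i
    using chain by (simp add: markov_chain_def)
  show ?thesis
    unfolding integral_exit_step_funpow[OF assms] exit_time_le_iff
    by (rule finite_measure_mono) (auto intro: less_imp_le)
qed

section \<open>Mixing of the adjusted kernel\<close>

theorem theorem1:
  fixes M :: "'w measure"
    and \<mu> \<nu> :: "'s::{metric_space, second_countable_topology} measure"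
    and \<pi>u \<pi>r \<pi> :: "'s \<Rightarrow> 's measure"
    and \<Phi> \<Psi> :: "'w \<Rightarrow> 's \<Rightarrow> 's"
    and U :: "'w \<Rightarrow> real"
    and \<alpha> :: "'s \<Rightarrow> 's \<Rightarrow> real"
    and D :: "'s set"
    and \<epsilon> R \<rho> C_Reg :: real
    and \<Pi>_Contr \<Pi>_Reg :: "'s \<times> 's \<Rightarrow> ('s \<times> 's) measure"
    and N\<nu> :: "'b measure" and X\<nu> :: "nat \<Rightarrow> 'b \<Rightarrow> 's"
    and N\<mu> :: "'c measure" and X\<mu> :: "nat \<Rightarrow> 'c \<Rightarrow> 's"
  assumes polish: "completely_metrizable_space (euclidean :: 's topology)"
    and prob: "prob_space M"
    and laws: "prob_law \<mu>" "prob_law \<nu>"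
    and kernels: "prob_kernel \<pi>u" "prob_kernel \<pi>r"
    and \<Phi>_meas: "(\<lambda>(\<omega>, x). \<Phi> \<omega> x) \<in> M \<Otimes>\<^sub>M borel \<rightarrow>\<^sub>M borel"
    and \<Psi>_meas: "(\<lambda>(\<omega>, x). \<Psi> \<omega> x) \<in> M \<Otimes>\<^sub>M borel \<rightarrow>\<^sub>M borel"
    and \<Phi>_law: "\<And>x. distr M borel (\<lambda>\<omega>. \<Phi> \<omega> x) = \<pi>u x"
    and \<Psi>_law: "\<And>x. distr M borel (\<lambda>\<omega>. \<Psi> \<omega> x) = \<pi>r x"
    and \<alpha>_meas: "(\<lambda>(x, y). \<alpha> x y) \<in> borel \<Otimes>\<^sub>M borel \<rightarrow>\<^sub>M borel"
    and \<alpha>_range: "\<And>x y. 0 \<le> \<alpha> x y \<and> \<alpha> x y \<le> 1"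
    and U_meas: "U \<in> M \<rightarrow>\<^sub>M borel"
    and U_law: "distr M borel U = uniform_measure lborel {0<..<1}"
    and U_indep: "\<And>x. indep_rv M borel U (borel \<Otimes>\<^sub>M borel) (\<lambda>\<omega>. (\<Phi> \<omega> x, \<Psi> \<omega> x))"
    and \<pi>_def: "\<pi> = adjusted_kernel M U \<alpha> \<Phi> \<Psi>"
    and invariant: "\<mu> \<bind> \<pi> = \<mu>"
    and \<epsilon>_pos: "\<epsilon> > 0"
    and D_meas: "D \<in> sets borel"
    and R_pos: "R > 0"
    and D_diam: "bounded D" "diameter D \<le> R"
    and \<rho>_pos: "\<rho> > 0"
    and Contr_coupling: "faithful_coupling_on D \<pi>u \<Pi>_Contr"
    and Contr: "\<And>x y. x \<in> D \<Longrightarrow> y \<in> D \<Longrightarrow>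
          integrable (\<Pi>_Contr (x, y)) (\<lambda>(x', y'). dist x' y') \<and>
          (\<integral>(x', y'). dist x' y' \<partial>\<Pi>_Contr (x, y)) \<le> (1 - \<rho>) * dist x y"
    and C_Reg_pos: "C_Reg > 0"
    and Reg_coupling: "faithful_coupling_on D \<pi>u \<Pi>_Reg"
    and Reg: "\<And>x y. x \<in> D \<Longrightarrow> y \<in> D \<Longrightarrow>
          measure (\<Pi>_Reg (x, y)) (- Id) \<le> C_Reg * dist x y"
    and epoch_length_pos: "epoch_length \<rho> C_Reg R \<ge> 1"
    and epoch_count_nonneg: "epoch_count \<epsilon> \<ge> 0"
    and rejection: "ennreal (real_of_int (epoch_length \<rho> C_Reg R)) *
          (SUP x\<in>D. emeasure M (space M - accept_event M U \<alpha> \<Phi> x)) \<le> ennreal (1 / (3 * exp 1))"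
    and chain_\<nu>: "markov_chain N\<nu> X\<nu> \<pi> \<nu>"
    and chain_\<mu>: "markov_chain N\<mu> X\<mu> \<pi> \<mu>"
    and exit_\<nu>: "measure N\<nu> {\<omega> \<in> space N\<nu>.
          exit_time X\<nu> D \<omega> \<le> enat (nat (total_steps \<rho> C_Reg R \<epsilon>))} \<le> \<epsilon> / 4"
    and exit_\<mu>: "measure N\<mu> {\<omega> \<in> space N\<mu>.
          exit_time X\<mu> D \<omega> \<le> enat (nat (total_steps \<rho> C_Reg R \<epsilon>))} \<le> \<epsilon> / 4"
  shows "mixing_time \<pi> \<mu> \<epsilon> \<nu> \<le> enat (nat (total_steps \<rho> C_Reg R \<epsilon>))"
proof -
  \<comment> \<open>An epoch has \<open>Suc n\<close> steps, of which \<open>n\<close> contract and one regularises.\<close>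
  define n where "n = nat (epoch_length \<rho> C_Reg R - 1)"
  define k where "k = nat (epoch_count \<epsilon>)"
  have n: "real (Suc n) = real_of_int (epoch_length \<rho> C_Reg R)"
    using epoch_length_pos by (simp add: n_def)
  have k: "int k = epoch_count \<epsilon>"
    using epoch_count_nonneg by (simp add: k_def)
  have "int (Suc n * k) = total_steps \<rho> C_Reg R \<epsilon>"
    unfolding total_steps_def k[symmetric] of_nat_mult using epoch_length_pos by (simp add: n_def)
  then have steps: "nat (total_steps \<rho> C_Reg R \<epsilon>) = Suc n * k" by linarith
  define p where "p = 1 / (3 * exp 1) / real (Suc n)"
  have reject_total: "2 * p * real (Suc n) = 2 / (3 * exp 1)"
    unfolding p_def by (simp del: of_nat_Suc)

  interpret M: prob_space M by (rule prob)
  note adj = prob U_meas \<alpha>_meas \<alpha>_range \<Phi>_meas \<Psi>_meas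
  have kernel: "prob_kernel \<pi>"
    unfolding \<pi>_def by (rule prob_kernel_adjusted_kernel[OF adj])
  have reject_le: "measure M (space M - accept_event M U \<alpha> \<Phi> x) \<le> p" if "x \<in> D" for x
  proof -
    let ?r = "measure M (space M - accept_event M U \<alpha> \<Phi> x)"
    have "ennreal (real (Suc n) * ?r)
        = ennreal (real (Suc n)) * emeasure M (space M - accept_event M U \<alpha> \<Phi> x)"
      by (subst M.emeasure_eq_measure) (rule ennreal_mult, auto)
    also have "\<dots> \<le> ennreal (real (Suc n)) * (SUP x\<in>D. emeasure M (space M - accept_event M U \<alpha> \<Phi> x))"
      using that by (intro mult_left_mono SUP_upper) auto
    also have "\<dots> \<le> ennreal (1 / (3 * exp 1))"
      using rejection by (simp only: n)
    finally have "real (Suc n) * ?r \<le> 1 / (3 * exp 1)"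
      by (subst (asm) ennreal_le_iff) auto
    then have "?r \<le> 1 / (3 * exp 1) / real (Suc n)"
      by (subst pos_le_divide_eq) (auto simp: mult.commute)
    then show ?thesis by (simp add: p_def)
  qed
  interpret minorised_kernel \<pi> \<pi>u \<alpha> D p
  proof
    show "unit_fun (\<alpha> x)" for x by (rule unit_fun_acceptance[OF adj])
    show "minorised_by (\<pi> x) (\<alpha> x) (\<pi>u x)" for x
      using minorised_by_adjusted_kernel[OF adj U_law U_indep, of x] by (simp add: \<pi>_def \<Phi>_law)
    show "1 - (\<integral>z. \<alpha> x z \<partial>\<pi>u x) \<le> p" if "x \<in> D" for x
      using reject_le[OF that] rejection_prob_eq[OF adj U_law U_indep, of x] by (simp add: \<Phi>_law)
  qed (auto simp: kernel D_meas p_def)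

  \<comment> \<open>The \<open>n\<close> contractive steps bring the distance term down to \<open>1/(3e)\<close>; the \<open>Suc n\<close> pairs of
    possible rejections add \<open>2/(3e)\<close>.\<close>
  have "ln (3 * exp 1 * C_Reg * R) / \<rho> \<le> real n"
    using n unfolding epoch_length_def by linarith
  then have "ln (3 * exp 1 * C_Reg * R) \<le> \<rho> * real n"
    using \<rho>_pos by (simp add: field_simps)
  then have "exp (- (\<rho> * real n)) \<le> exp (- ln (3 * exp 1 * C_Reg * R))" by simp
  also have "\<dots> = 1 / (3 * exp 1 * C_Reg * R)"
    using C_Reg_pos R_pos by (simp add: exp_minus inverse_eq_divide)
  finally have "C_Reg * exp (- (\<rho> * real n)) * R \<le> C_Reg * (1 / (3 * exp 1 * C_Reg * R)) * R"
    using C_Reg_pos R_pos by (intro mult_right_mono mult_left_mono) auto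
  also have "\<dots> = 1 / (3 * exp 1)" using C_Reg_pos R_pos by simp
  finally have "C_Reg * exp (- (\<rho> * real n)) * R + 2 * p * real (Suc n) \<le> 1 / (3 * exp 1) + 2 / (3 * exp 1)"
    by (simp only: reject_total)
  also have "\<dots> = exp (- 1)" by (simp add: exp_minus field_simps)
  finally have factor: "C_Reg * exp (- (\<rho> * real n)) * R + 2 * p * real (Suc n) \<le> exp (- 1)" .

  define u where "u = (exit_step \<pi> D ^^ (Suc n * k)) (\<lambda>_. 0)"
  have u: "unit_fun u"
    unfolding u_def by (intro unit_fun_exit_step_funpow kernel D_meas) (simp add: unit_fun_def)
  have u_\<nu>: "(\<integral>x. u x \<partial>\<nu>) \<le> \<epsilon> / 4"
    using integral_exit_step_funpow_le[OF chain_\<nu> kernel D_meas, of "Suc n * k"] exit_\<nu>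
    unfolding steps u_def by (rule order_trans)
  have u_\<mu>: "(\<integral>x. u x \<partial>\<mu>) \<le> \<epsilon> / 4"
    using integral_exit_step_funpow_le[OF chain_\<mu> kernel D_meas, of "Suc n * k"] exit_\<mu>
    unfolding steps u_def by (rule order_trans)
  have "ln (2 / \<epsilon>) \<le> real k"
    using k unfolding epoch_count_def by linarith
  then have "exp (- real k) \<le> exp (- ln (2 / \<epsilon>))" by simp
  also have "\<dots> = \<epsilon> / 2" using \<epsilon>_pos by (simp add: exp_minus)
  finally have exp_k: "exp (- real k) \<le> \<epsilon> / 2" .

  have \<mu>_iter: "kernel_iter \<pi> m \<mu> = \<mu>" for m
    by (induction m) (simp_all add: kernel_iter_def invariant)
  have "\<bar>measure (kernel_iter \<pi> (Suc n * k) \<nu>) B - measure \<mu> B\<bar> \<le> \<epsilon>" if B: "B \<in> sets borel" for B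
  proof -
    have f: "unit_fun (indicat_real B)"
      using B by (simp add: unit_fun_def indicator_def borel_measurable_indicator)
    define F where "F = (kernel_act \<pi> ^^ (Suc n * k)) (indicat_real B)"
    have F: "unit_fun F" unfolding F_def by (rule unit_fun_kernel_act_funpow[OF kernel f])
    have osc: "F x - F y \<le> exp (- real k) + u x + u y" for x y
      unfolding F_def u_def
    proof (rule kernel_act_diff_le_epochs[where c=C_Reg and R=R and \<rho>=\<rho>])
      fix x y assume xy: "x \<in> D" "y \<in> D"
      show "\<exists>C. coupling (\<pi>u x) (\<pi>u y) C \<and> integrable C (\<lambda>z. dist (fst z) (snd z)) \<and>
          (\<integral>z. dist (fst z) (snd z) \<partial>C) \<le> (1 - \<rho>) * dist x y"
        using Contr_coupling Contr[OF xy] xy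
        by (intro exI[of _ "\<Pi>_Contr (x, y)"]) (auto simp: faithful_coupling_on_def case_prod_beta')
      show "\<exists>C. coupling (\<pi>u x) (\<pi>u y) C \<and> measure C (- Id) \<le> C_Reg * dist x y"
        using Reg_coupling Reg[OF xy] xy
        by (intro exI[of _ "\<Pi>_Reg (x, y)"]) (auto simp: faithful_coupling_on_def)
      show "dist x y \<le> R"
        using diameter_bounded_bound[OF D_diam(1) xy] D_diam(2) by simp
    qed (use C_Reg_pos R_pos factor f in auto)
    have eq: "measure (kernel_iter \<pi> (Suc n * k) \<eta>) B = (\<integral>x. F x \<partial>\<eta>)" if "prob_law \<eta>" for \<eta>
    proof -
      note law = prob_law_kernel_iter[OF kernel that, of "Suc n * k"]
      have "B \<in> sets (kernel_iter \<pi> (Suc n * k) \<eta>)" using B prob_lawD(2)[OF law] by simp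
      then show ?thesis
        using integral_kernel_iter[OF kernel that f, of "Suc n * k"] by (simp add: F_def)
    qed
    have "(\<integral>x. F x \<partial>\<nu>) - (\<integral>x. F x \<partial>\<mu>) \<le> exp (- real k) + (\<integral>x. u x \<partial>\<nu>) + (\<integral>x. u x \<partial>\<mu>)"
      by (rule integral_diff_le_osc[OF laws(2,1) F u osc])
    moreover have "(\<integral>x. F x \<partial>\<mu>) - (\<integral>x. F x \<partial>\<nu>) \<le> exp (- real k) + (\<integral>x. u x \<partial>\<mu>) + (\<integral>x. u x \<partial>\<nu>)"
      by (rule integral_diff_le_osc[OF laws F u osc])
    ultimately show ?thesis
      using eq[OF laws(1)] eq[OF laws(2)] u_\<nu> u_\<mu> exp_k unfolding \<mu>_iter by linarith
  qed
  then have "tv_dist (kernel_iter \<pi> (Suc n * k) \<nu>) \<mu> \<le> \<epsilon>"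
    unfolding tv_dist_def by (intro cSUP_least) auto
  then show ?thesis
    unfolding mixing_time_def steps by (intro INF_lower) simp
qed

end
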